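(* Assume the principle $\diamondsuit({}^{\omega}\omega,<)$. If $\mathcal{A}$ is an almost disjoint family of infinite subsets of $\omega$ such that the space $\Psi(\mathcal{A})$ is a selectively $(a)$-space, then $\Psi(\mathcal{A})$ is countable.
   Context: Almost disjoint family: a set $\mathcal{A}$ of infinite subsets of $\omega$ such that $X\cap Y$ is finite for all distinct $X,Y\in\mathcal{A}$. The space $\Psi(\mathcal{A})$ has underlying set $\mathcal{A}\cup\omega$ (disjoint union); points of $\omega$ are isolated, and the basic neighbourhoods of $A\in\mathcal{A}$ are the sets $\{A\}\cup(A\setminus F)$ for $F$ a finite subset of $\omega$. For a topological space $X$, a cover $\mathcal{U}$ of $X$ and $S\subseteq X$, put $St(S,\mathcal{U})=\bigcup\{U\in\mathcal{U}:U\cap S\neq\emptyset\}$. $X$ is a selectively $(a)$-space if for every sequence $\langle\mathcal{U}_n:n<\omega\rangle$ of open covers of $X$ and every dense $D\subseteq X$ there is a sequence $\langle S_n:n<\omega\rangle$ of subsets of $D$, each closed and discrete in $X$, such that $\{St(S_n,\mathcal{U}_n):n<\omega\}$ covers $X$. ${}^{X}Y$ denotes the set of functions from $X$ to $Y$, and ${}^{<\omega_1}2=\bigcup_{\alpha<\omega_1}{}^{\alpha}2$. For $f,g\in{}^{\omega}\omega$, $f<g$ means $f(n)<g(n)$ for every $n<\omega$. The spaces ${}^{\omega}\omega$ and ${}^{\alpha}2$ ($\alpha<\omega_1$) carry the product topology of discrete spaces. A map between Borel subsets of Polish spaces is Borel if preimages of Borel sets are Borel. A map $F:{}^{<\omega_1}2\to{}^{\omega}\omega$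 is called Borel if, for each $\alpha<\omega_1$, its restriction $F\upharpoonright{}^{\alpha}2$ is Borel. The principle $\diamondsuit({}^{\omega}\omega,<)$ is the statement: for every Borel $F:{}^{<\omega_1}2\to{}^{\omega}\omega$ there is $g:\omega_1\to{}^{\omega}\omega$ such that for every $f\in{}^{\omega_1}2$ the set $\{\alpha<\omega_1: F(f\upharpoonright\alpha)<g(\alpha)\}$ is stationary in $\omega_1$. *)

theory Defs
  imports "HOL-Analysis.Analysis" "HOL-Library.Countable_Set_Type"
begin

text \<open>The ordinal \<open>\<omega>\<^sub>1\<close> is rendered as a well-ordered type: its elements are the countable
  ordinals, and \<open>{..<\<alpha>}\<close> plays the role of the ordinal \<open>\<alpha>\<close> regarded as a set.  Being
  uncountable with all proper initial segments countable determines the order up to isomorphism.\<close>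

typedef omega1 = "Field (cardSuc natLeq)"
proof -
  have "infinite (Field (cardSuc natLeq))"
    using Cinfinite_cardSuc[OF natLeq_Cinfinite] unfolding cinfinite_def by blast
  then have "Field (cardSuc natLeq) \<noteq> {}" by auto
  then show ?thesis by blast
qed

lemma Well_order_cardSuc_natLeq: "Well_order (cardSuc natLeq)"
  using cardSuc_Card_order[OF natLeq_Card_order] unfolding card_order_on_def by blast

instantiation omega1 :: linorder
begin

definition less_eq_omega1 :: "omega1 \<Rightarrow> omega1 \<Rightarrow> bool"
  where "\<alpha> \<le> \<beta> \<longleftrightarrow> (Rep_omega1 \<alpha>, Rep_omega1 \<beta>) \<in> cardSuc natLeq"

definition less_omega1 :: "omega1 \<Rightarrow> omega1 \<Rightarrow> bool"
  where "\<alpha> < \<beta> \<longleftrightarrow> \<alpha> \<le> \<beta> \<and> \<not> \<beta> \<le> (\<alpha> :: omega1)"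

instance
proof -
  note r = Well_order_cardSuc_natLeq[unfolded well_order_on_def linear_order_on_def
      partial_order_on_def preorder_on_def]
  show "OFCLASS(omega1, linorder_class)"
  proof
    fix x y z :: omega1
    show "(x < y) = (x \<le> y \<and> \<not> y \<le> x)" by (simp add: less_omega1_def)
    show "x \<le> x"
      using r Rep_omega1[of x] by (auto simp: less_eq_omega1_def refl_on_def)
    show "x \<le> z" if "x \<le> y" "y \<le> z"
      using r that unfolding less_eq_omega1_def by (blast dest: transD)
    show "x = y" if "x \<le> y" "y \<le> x"
      using r that unfolding less_eq_omega1_def
      by (metis antisymD Rep_omega1_inject)
    show "x \<le> y \<or> y \<le> x"
      using r Rep_omega1[of x] Rep_omega1[of y] \<open>x \<le> x\<close>
      by (cases "x = y") (auto simp: less_eq_omega1_def total_on_def Rep_omega1_inject)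
  qed
qed

end

instance omega1 :: wellorder
proof
  fix P :: "omega1 \<Rightarrow> bool" and a
  assume step: "\<And>x. (\<And>y. y < x \<Longrightarrow> P y) \<Longrightarrow> P x"
  have "wf (inv_image (cardSuc natLeq - Id) Rep_omega1)"
    using Well_order_cardSuc_natLeq unfolding well_order_on_def by (intro wf_inv_image) blast
  then show "P a"
  proof (induction a rule: wf_induct_rule)
    case (less x)
    have "P y" if "y < x" for y
    proof (rule less)
      have "y \<le> x" "y \<noteq> x" using that by auto
      then show "(y, x) \<in> inv_image (cardSuc natLeq - Id) Rep_omega1"
        by (simp add: less_eq_omega1_def Rep_omega1_inject)
    qed
    then show "P x" by (rule step)
  qed
qed

lemma uncountable_omega1: "uncountable (UNIV :: omega1 set)"
proof
  include cardinal_syntax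
  assume "countable (UNIV :: omega1 set)"
  then have "countable (range Rep_omega1)" by blast
  then have "countable (Field (cardSuc natLeq))"
    using type_definition.Rep_range[OF type_definition_omega1] by simp
  then have "|Field (cardSuc natLeq)| \<le>o natLeq" by (simp add: countable_card_le_natLeq)
  then have "cardSuc natLeq \<le>o natLeq"
    using card_of_Field_ordIso[OF cardSuc_Card_order[OF natLeq_Card_order]]
    by (meson ordIso_ordLeq_trans ordIso_symmetric)
  then show False
    using cardSuc_greater[OF natLeq_Card_order] not_ordLess_ordLeq by blast
qed

lemma countable_lessThan_omega1: "countable {..<\<alpha> :: omega1}"
proof -
  include cardinal_syntax
  have "|underS (cardSuc natLeq) (Rep_omega1 \<alpha>)| <o cardSuc natLeq"
    using card_of_underS[OF cardSuc_Card_order[OF natLeq_Card_order] Rep_omega1] .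
  then have "countable (underS (cardSuc natLeq) (Rep_omega1 \<alpha>))"
    unfolding countable_card_le_natLeq
    by (rule cardSuc_ordLeq_ordLess[OF natLeq_Card_order card_of_Card_order, THEN iffD1])
  moreover have "Rep_omega1 ` {..<\<alpha>} \<subseteq> underS (cardSuc natLeq) (Rep_omega1 \<alpha>)"
    by (auto simp: underS_def less_le less_eq_omega1_def Rep_omega1_inject)
  ultimately show ?thesis
    by (meson countable_subset countable_image_inj_on inj_on_def Rep_omega1_inject)
qed

definition club :: "omega1 set \<Rightarrow> bool" where
  "club C \<longleftrightarrow>
     (\<forall>\<alpha>. \<exists>\<gamma>\<in>C. \<alpha> < \<gamma>) \<and>
     (\<forall>\<alpha>. (\<exists>\<beta>. \<beta> < \<alpha>) \<and> (\<forall>\<beta><\<alpha>. \<exists>\<gamma>\<in>C. \<beta> < \<gamma> \<and> \<gamma> < \<alpha>) \<longrightarrow> \<alpha> \<in> C)"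

definition stationary :: "omega1 set \<Rightarrow> bool" where
  "stationary S \<longleftrightarrow> (\<forall>C. club C \<longrightarrow> S \<inter> C \<noteq> {})"

definition borel_algebra :: "'a topology \<Rightarrow> 'a measure" where
  "borel_algebra X = sigma (topspace X) {U. openin X U}"

definition cantor_topology :: "omega1 \<Rightarrow> (omega1 \<Rightarrow> bool) topology" where
  "cantor_topology \<alpha> = product_topology (\<lambda>_. discrete_topology UNIV) {..<\<alpha>}"

text \<open>An element of \<open>\<^sup>\<alpha>2\<close> is represented by a function on \<open>omega1\<close> that is \<open>undefined\<close> outside
  \<open>{..<\<alpha>}\<close>.  Since \<open>undefined\<close> is itself a Boolean, such a function does not determine its
  domain \<open>\<alpha>\<close>; a map on the (disjoint) union of all \<open>\<^sup>\<alpha>2\<close>, \<open>\<alpha> < \<omega>\<^sub>1\<close>, therefore takes \<open>\<alpha>\<close> as an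
  additional argument, and its value \<open>F \<alpha> s\<close> is relevant only for \<open>s\<close> in \<open>\<^sup>\<alpha>2\<close>.  On
  \<open>nat \<Rightarrow> nat\<close>, \<open>borel\<close> refers to the product of the discrete topologies.\<close>

definition borel_map :: "(omega1 \<Rightarrow> (omega1 \<Rightarrow> bool) \<Rightarrow> (nat \<Rightarrow> nat)) \<Rightarrow> bool" where
  "borel_map F \<longleftrightarrow> (\<forall>\<alpha>. F \<alpha> \<in> measurable (borel_algebra (cantor_topology \<alpha>)) borel)"

text \<open>The order \<open>f < g\<close> of the principle is strict at every coordinate, unlike the
  type-class order on functions.\<close>

definition diamond_omega_omega_less :: bool where
  "diamond_omega_omega_less \<longleftrightarrow>
     (\<forall>F. borel_map F \<longrightarrow>
        (\<exists>g :: omega1 \<Rightarrow> nat \<Rightarrow> nat. \<forall>f :: omega1 \<Rightarrow> bool.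
           stationary {\<alpha>. \<forall>n. F \<alpha> (restrict f {..<\<alpha>}) n < g \<alpha> n}))"

definition almost_disjoint_family :: "nat set set \<Rightarrow> bool" where
  "almost_disjoint_family \<A> \<longleftrightarrow>
     (\<forall>A\<in>\<A>. infinite A) \<and> (\<forall>A\<in>\<A>. \<forall>B\<in>\<A>. A \<noteq> B \<longrightarrow> finite (A \<inter> B))"

definition Psi :: "nat set set \<Rightarrow> (nat set + nat) topology" where
  "Psi \<A> = topology_generated_by
     ({{Inr n} | n. True} \<union> {insert (Inl A) (Inr ` (A - F)) | A F. A \<in> \<A> \<and> finite F})"

lemma topspace_Psi: "topspace (Psi \<A>) = Inl ` \<A> \<union> range Inr"
  by (auto simp: Psi_def)

lemma openin_Psi_iff:
  "openin (Psi \<A>) U \<longleftrightarrow>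
     U \<subseteq> Inl ` \<A> \<union> range Inr \<and>
     (\<forall>A\<in>\<A>. Inl A \<in> U \<longrightarrow> (\<exists>F. finite F \<and> insert (Inl A) (Inr ` (A - F)) \<subseteq> U))"
    (is "_ \<longleftrightarrow> ?Q U")
proof
  assume op: "openin (Psi \<A>) U"
  then have "generate_topology_on
     ({{Inr n} | n. True} \<union> {insert (Inl A) (Inr ` (A - F)) | A F. A \<in> \<A> \<and> finite F}) U"
    unfolding Psi_def by (rule openin_topology_generated_by)
  then have "\<forall>A\<in>\<A>. Inl A \<in> U \<longrightarrow> (\<exists>F. finite F \<and> insert (Inl A) (Inr ` (A - F)) \<subseteq> U)"
  proof induction
    case Empty
    show ?case by simp
  next
    case (Int a b)
    show ?case
    proof (intro ballI impI)
      fix A assume A: "A \<in> \<A>" "Inl A \<in> a \<inter> b"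
      obtain F where F: "finite F" "insert (Inl A) (Inr ` (A - F)) \<subseteq> a"
        using Int.IH(1)[rule_format, OF A(1) IntD1[OF A(2)]] by (elim exE conjE)
      obtain G where G: "finite G" "insert (Inl A) (Inr ` (A - G)) \<subseteq> b"
        using Int.IH(2)[rule_format, OF A(1) IntD2[OF A(2)]] by (elim exE conjE)
      from F G show "\<exists>F. finite F \<and> insert (Inl A) (Inr ` (A - F)) \<subseteq> a \<inter> b"
        by (intro exI[of _ "F \<union> G"]) auto
    qed
  next
    case (UN K)
    show ?case
    proof (intro ballI impI)
      fix A assume A: "A \<in> \<A>" "Inl A \<in> \<Union>K"
      from A(2) obtain k where k: "k \<in> K" "Inl A \<in> k" by (elim UnionE)
      with UN.IH[OF k(1), rule_format, OF A(1) k(2)]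
      show "\<exists>F. finite F \<and> insert (Inl A) (Inr ` (A - F)) \<subseteq> \<Union>K"
        by (meson Sup_upper subset_trans)
    qed
  next
    case (Basis s)
    then show ?case by auto
  qed
  moreover have "U \<subseteq> Inl ` \<A> \<union> range Inr"
    using openin_subset[OF op] by (simp add: topspace_Psi)
  ultimately show "?Q U" by blast
next
  assume Q: "?Q U"
  show "openin (Psi \<A>) U"
  proof (subst openin_subopen, intro ballI)
    fix x assume x: "x \<in> U"
    show "\<exists>T. openin (Psi \<A>) T \<and> x \<in> T \<and> T \<subseteq> U"
    proof (cases x)
      case (Inl A)
      with Q x have "A \<in> \<A>" by auto
      with Q x Inl obtain F where "finite F" "insert (Inl A) (Inr ` (A - F)) \<subseteq> U" by blast
      moreover have "openin (Psi \<A>) (insert (Inl A) (Inr ` (A - F)))"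
        unfolding Psi_def using \<open>A \<in> \<A>\<close> \<open>finite F\<close>
        by (intro topology_generated_by_Basis) blast
      ultimately show ?thesis using Inl by blast
    next
      case (Inr n)
      have "openin (Psi \<A>) {Inr n}"
        unfolding Psi_def by (intro topology_generated_by_Basis) blast
      then show ?thesis using Inr x by blast
    qed
  qed
qed

definition St :: "'a set \<Rightarrow> 'a set set \<Rightarrow> 'a set" where
  "St S \<U> = \<Union>{U \<in> \<U>. U \<inter> S \<noteq> {}}"

definition open_cover :: "'a topology \<Rightarrow> 'a set set \<Rightarrow> bool" where
  "open_cover X \<U> \<longleftrightarrow> (\<forall>U\<in>\<U>. openin X U) \<and> \<Union>\<U> = topspace X"

definition selectively_a_space :: "'a topology \<Rightarrow> bool" where
  "selectively_a_space X \<longleftrightarrow>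
     (\<forall>\<U> :: nat \<Rightarrow> 'a set set. \<forall>D.
        (\<forall>n. open_cover X (\<U> n)) \<and> D \<subseteq> topspace X \<and> X closure_of D = topspace X \<longrightarrow>
        (\<exists>S :: nat \<Rightarrow> 'a set.
           (\<forall>n. S n \<subseteq> D \<and> closedin X (S n) \<and>
                subtopology X (S n) = discrete_topology (S n)) \<and>
           (\<Union>n. St (S n) (\<U> n)) = topspace X))"

end

theory Submission
  imports Defs
begin

text \<open>In \<open>\<Psi>(\<A>)\<close> a set of isolated points is closed (and then discrete) precisely when it meets each
  member of \<open>\<A>\<close> in a finite set.  Given thresholds \<open>h n A\<close>, let the \<open>n\<close>-th cover consist of the
  neighbourhoods of the points \<open>A\<close> obtained by deleting the numbers below \<open>h n A\<close>, together with
  the isolated points.  Selective (a)-ness for these covers and the dense set \<open>\<omega>\<close> yields sets \<open>P n\<close>,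
  each almost disjoint from every member of \<open>\<A>\<close>, such that for each \<open>A\<close> some \<open>P n \<inter> A\<close> reaches
  beyond the threshold \<open>h n A\<close> (\<open>selectively_a_Psi_escapes\<close>).

  If \<open>\<A>\<close> is uncountable, it contains distinct sets \<open>A \<alpha>\<close>, \<open>\<alpha> < \<omega>\<^sub>1\<close>, and the diamond principle supplies
  thresholds that no such sequence escapes (\<open>diamond_bounds_traces\<close>).  Indeed, a sequence of subsets
  of \<open>\<omega>\<close> is a real, hence is coded by the values of some \<open>f \<in> \<^sup>\<omega>\<^sub>12\<close> on a countable set of
  coordinates; from \<open>f \<restriction> \<alpha>\<close>, for all large \<open>\<alpha>\<close>, the function sending \<open>n\<close> to the least strict upper
  bound of \<open>P n \<inter> A \<alpha>\<close> is recovered in a Borel way.  The guess \<open>g \<alpha>\<close> exceeds this function for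
  stationarily many \<open>\<alpha>\<close>, hence for some large \<open>\<alpha>\<close>.  With \<open>h n (A \<alpha>) = g \<alpha> n\<close> this contradicts
  the escape at the point \<open>A \<alpha>\<close>.\<close>

lemma countable_subset_lessThan_omega1:
  fixes X :: "omega1 set"
  assumes "countable X"
  shows "\<exists>\<delta>. X \<subseteq> {..<\<delta>}"
proof (rule ccontr)
  assume "\<nexists>\<delta>. X \<subseteq> {..<\<delta>}"
  then have "UNIV = (\<Union>x\<in>X. {..<x} \<union> {x})"
    by (auto simp: subset_iff not_less) (metis le_less)
  moreover have "countable (\<Union>x\<in>X. {..<x} \<union> {x})"
    using assms countable_lessThan_omega1 by auto
  ultimately show False
    using uncountable_omega1 by metis
qed

lemma club_atLeast: "club {\<delta>..}"
  unfolding club_def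
proof (intro conjI allI impI)
  fix \<alpha>
  obtain \<gamma> where "{\<alpha>, \<delta>} \<subseteq> {..<\<gamma>}"
    using countable_subset_lessThan_omega1[of "{\<alpha>, \<delta>}"] by auto
  then show "\<exists>\<gamma>\<in>{\<delta>..}. \<alpha> < \<gamma>"
    by (intro bexI[of _ \<gamma>]) auto
next
  fix \<alpha>
  assume "(\<exists>\<beta>. \<beta> < \<alpha>) \<and> (\<forall>\<beta><\<alpha>. \<exists>\<gamma>\<in>{\<delta>..}. \<beta> < \<gamma> \<and> \<gamma> < \<alpha>)"
  then show "\<alpha> \<in> {\<delta>..}" by force
qed

lemma uncountable_imp_inj_omega1:
  fixes X :: "'a set"
  assumes "uncountable X"
  shows "\<exists>a :: omega1 \<Rightarrow> 'a. inj a \<and> range a \<subseteq> X"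
proof -
  include cardinal_syntax
  have "\<not> |X| \<le>o natLeq"
    using assms by (simp add: countable_card_le_natLeq)
  then have "natLeq <o |X|"
    using not_ordLeq_iff_ordLess[OF natLeq_Well_order card_of_Well_order] by blast
  then have "cardSuc natLeq \<le>o |X|"
    by (rule cardSuc_least[OF natLeq_Card_order card_of_Card_order])
  then have "|Field (cardSuc natLeq)| \<le>o |X|"
    using card_of_Field_ordIso[OF cardSuc_Card_order[OF natLeq_Card_order]]
    by (rule ordIso_ordLeq_trans[rotated])
  then obtain b where b: "inj_on b (Field (cardSuc natLeq))" "b ` Field (cardSuc natLeq) \<subseteq> X"
    unfolding card_of_ordLeq[symmetric] by blast
  have "inj (b \<circ> Rep_omega1)"
    using b(1) Rep_omega1 by (auto simp: inj_on_def Rep_omega1_inject[symmetric])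
  moreover have "range (b \<circ> Rep_omega1) \<subseteq> X"
    using b(2) Rep_omega1 by auto
  ultimately show ?thesis by blast
qed

lemma space_borel_algebra [simp]: "space (borel_algebra X) = topspace X"
  unfolding borel_algebra_def using openin_subset by (intro space_measure_of) auto

lemma sets_borel_algebra_openin: "openin X U \<Longrightarrow> U \<in> sets (borel_algebra X)"
  unfolding borel_algebra_def using openin_subset[of X]
  by (subst sets_measure_of) auto

text \<open>Coordinates outside \<open>{..<\<alpha>}\<close> are covered too: there the representing functions are constant.
  A decoding map can therefore be written uniformly in \<open>\<alpha>\<close>, although it decodes correctly only for
  large \<open>\<alpha>\<close>.\<close>

lemma measurable_cantor_coordinate:
  "Measurable.pred (borel_algebra (cantor_topology \<alpha>)) (\<lambda>s. s \<beta>)"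
proof (cases "\<beta> < \<alpha>")
  case True
  have "continuous_map (cantor_topology \<alpha>) (discrete_topology UNIV) (\<lambda>s. s \<beta>)"
    unfolding cantor_topology_def using True by (intro continuous_map_product_projection) simp
  then have "openin (cantor_topology \<alpha>) {s \<in> topspace (cantor_topology \<alpha>). s \<beta> \<in> {True}}"
    by (rule openin_continuous_map_preimage) simp
  then show ?thesis
    by (auto dest: sets_borel_algebra_openin simp: pred_def)
next
  case False
  then have "s \<beta> = undefined" if "s \<in> space (borel_algebra (cantor_topology \<alpha>))" for s
    using that by (auto simp: cantor_topology_def PiE_def extensional_def)
  then show ?thesis
    by (subst measurable_cong[where g = "\<lambda>_. undefined"]) auto
qed

text \<open>The decoding map: a function \<open>s\<close> codes the sets \<open>P n = {k. s (e n k)}\<close>, and \<open>B\<close> is the set whose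
  intersections with them are bounded.  The value at \<open>n\<close> is meaningful when \<open>P n \<inter> B\<close> is finite;
  otherwise it is one fixed default number, which keeps the map Borel.\<close>

definition trace_bound ::
    "(nat \<Rightarrow> nat \<Rightarrow> omega1) \<Rightarrow> nat set \<Rightarrow> (omega1 \<Rightarrow> bool) \<Rightarrow> nat \<Rightarrow> nat" where
  "trace_bound e B s n = (LEAST m. \<forall>k. k \<in> B \<and> s (e n k) \<longrightarrow> k < m)"

lemma trace_bound_greater:
  assumes "finite {k \<in> B. s (e n k)}" "k \<in> B" "s (e n k)"
  shows "k < trace_bound e B s n"
proof -
  have "\<exists>m. \<forall>k. k \<in> B \<and> s (e n k) \<longrightarrow> k < m"
    using assms(1) by (auto simp: finite_nat_set_iff_bounded)
  from LeastI_ex[OF this] show ?thesis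
    using assms(2,3) unfolding trace_bound_def by blast
qed

text \<open>A least number satisfying a countable conjunction of conditions on single coordinates depends
  on \<open>s\<close> in a Borel way.\<close>

lemma borel_map_trace_bound: "borel_map (\<lambda>\<alpha>. trace_bound e (A \<alpha>))"
  unfolding borel_map_def
proof (intro allI measurable_coordinatewise_then_product)
  fix \<alpha> n
  let ?M = "borel_algebra (cantor_topology \<alpha>)"
  note measurable_cantor_coordinate[measurable]
  have "(\<lambda>s. trace_bound e (A \<alpha>) s n) \<in> measurable ?M (count_space UNIV)"
    unfolding trace_bound_def by measurable
  then show "(\<lambda>s. trace_bound e (A \<alpha>) s n) \<in> borel_measurable ?M"
    by (rule measurable_compose) simp
qed

lemma diamond_bounds_traces:
  fixes A :: "omega1 \<Rightarrow> nat set"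
  assumes "diamond_omega_omega_less"
  shows "\<exists>g :: omega1 \<Rightarrow> nat \<Rightarrow> nat. \<forall>P :: nat \<Rightarrow> nat set.
           (\<forall>n \<alpha>. finite (P n \<inter> A \<alpha>)) \<longrightarrow> (\<exists>\<alpha>. \<forall>n. \<forall>k \<in> P n \<inter> A \<alpha>. k < g \<alpha> n)"
proof -
  have "infinite (UNIV :: omega1 set)"
    using uncountable_omega1 uncountable_infinite by blast
  then obtain c :: "nat \<Rightarrow> omega1" where c: "inj c"
    using infinite_countable_subset by blast
  define e where "e n k = c (prod_encode (n, k))" for n k
  have e_eq: "e n k = e n' k' \<longleftrightarrow> n = n' \<and> k = k'" for n k n' k'
    using c by (auto simp: e_def inj_eq)
  obtain \<delta> where "range c \<subseteq> {..<\<delta>}"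
    using countable_subset_lessThan_omega1[of "range c"] by auto
  then have e_less: "e n k < \<delta>" for n k
    by (auto simp: e_def)
  obtain g :: "omega1 \<Rightarrow> nat \<Rightarrow> nat" where g: "\<And>f. stationary
      {\<alpha>. \<forall>n. trace_bound e (A \<alpha>) (restrict f {..<\<alpha>}) n < g \<alpha> n}"
    using assms borel_map_trace_bound[of e A] unfolding diamond_omega_omega_less_def by blast
  show ?thesis
  proof (intro exI[of _ g] allI impI)
    fix P :: "nat \<Rightarrow> nat set"
    assume fin: "\<forall>n \<alpha>. finite (P n \<inter> A \<alpha>)"
    \<comment> \<open>The code of \<open>P\<close>; it lives on the coordinates \<open>e n k\<close>, all of them below \<open>\<delta>\<close>.\<close>
    define f where "f \<beta> \<longleftrightarrow> (\<exists>n k. \<beta> = e n k \<and> k \<in> P n)" for \<beta>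
    have f_e: "f (e n k) \<longleftrightarrow> k \<in> P n" for n k
      by (auto simp: f_def e_eq)
    obtain \<alpha> where "\<alpha> \<ge> \<delta>"
      and less: "\<And>n. trace_bound e (A \<alpha>) (restrict f {..<\<alpha>}) n < g \<alpha> n"
      using g[of f] club_atLeast[of \<delta>] unfolding stationary_def by blast
    have "restrict f {..<\<alpha>} (e n k) \<longleftrightarrow> k \<in> P n" for n k
      using less_le_trans[OF e_less[of n k] \<open>\<alpha> \<ge> \<delta>\<close>] by (simp add: f_e)
    moreover have "{k \<in> A \<alpha>. k \<in> P n} = P n \<inter> A \<alpha>" for n
      by blast
    ultimately have "k < trace_bound e (A \<alpha>) (restrict f {..<\<alpha>}) n" if "k \<in> P n \<inter> A \<alpha>" for n k
      using that fin by (intro trace_bound_greater) auto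
    then show "\<exists>\<alpha>. \<forall>n. \<forall>k \<in> P n \<inter> A \<alpha>. k < g \<alpha> n"
      using less less_trans by blast
  qed
qed

lemma openin_Psi_neighbourhood:
  assumes "openin (Psi \<A>) U" "A \<in> \<A>" "Inl A \<in> U"
  obtains F where "finite F" "Inr ` (A - F) \<subseteq> U"
proof -
  have "\<forall>A\<in>\<A>. Inl A \<in> U \<longrightarrow> (\<exists>F. finite F \<and> insert (Inl A) (Inr ` (A - F)) \<subseteq> U)"
    using assms(1) unfolding openin_Psi_iff by (rule conjunct2)
  from this[rule_format, OF assms(2,3)] show thesis
    using that by (elim exE conjE) simp
qed

lemma closure_of_isolated_points_Psi:
  assumes "\<And>A. A \<in> \<A> \<Longrightarrow> infinite A"
  shows "Psi \<A> closure_of range Inr = topspace (Psi \<A>)"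
proof (intro dense_intersects_open[THEN iffD2] allI impI)
  fix U
  assume "openin (Psi \<A>) U \<and> U \<noteq> {}"
  then obtain x where U: "openin (Psi \<A>) U" "x \<in> U" by blast
  show "range Inr \<inter> U \<noteq> {}"
  proof (cases x)
    case (Inl A)
    with U have "A \<in> \<A>" by (auto simp: openin_Psi_iff)
    with U Inl obtain F where F: "finite F" "Inr ` (A - F) \<subseteq> U"
      using openin_Psi_neighbourhood by metis
    have "A - F \<noteq> {}"
      using assms[OF \<open>A \<in> \<A>\<close>] F(1) by (metis finite.emptyI Diff_infinite_finite)
    with F(2) show ?thesis by blast
  next
    case (Inr k)
    with U show ?thesis by blast
  qed
qed

text \<open>The complement of \<open>S\<close> is a neighbourhood of the point \<open>A\<close>, so it contains almost all of \<open>A\<close>.\<close>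

lemma closedin_Psi_finite_trace:
  assumes "closedin (Psi \<A>) S" "S \<subseteq> range Inr" "A \<in> \<A>"
  shows "finite (Inr -` S \<inter> A)"
proof -
  have "openin (Psi \<A>) (topspace (Psi \<A>) - S)"
    using assms(1) by blast
  moreover have "Inl A \<in> topspace (Psi \<A>) - S"
    using assms(2,3) by (auto simp: topspace_Psi)
  ultimately obtain F where F: "finite F" "Inr ` (A - F) \<subseteq> topspace (Psi \<A>) - S"
    using assms(3) openin_Psi_neighbourhood by metis
  then have "Inr -` S \<inter> A \<subseteq> F" by blast
  with F(1) show ?thesis by (rule finite_subset[rotated])
qed

lemma selectively_a_Psi_escapes:
  fixes h :: "nat \<Rightarrow> nat set \<Rightarrow> nat"
  assumes "almost_disjoint_family \<A>" "selectively_a_space (Psi \<A>)"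
  shows "\<exists>P :: nat \<Rightarrow> nat set. (\<forall>n. \<forall>A\<in>\<A>. finite (P n \<inter> A)) \<and>
           (\<forall>A\<in>\<A>. \<exists>n. \<exists>k \<in> P n \<inter> A. h n A \<le> k)"
proof -
  define \<U> where "\<U> n = (\<lambda>A. insert (Inl A) (Inr ` (A - {..<h n A}))) ` \<A> \<union> range (\<lambda>k. {Inr k})"
    for n
  have cover: "open_cover (Psi \<A>) (\<U> n)" for n
    unfolding open_cover_def
  proof
    show "\<forall>U\<in>\<U> n. openin (Psi \<A>) U"
      unfolding \<U>_def openin_Psi_iff by (auto intro!: exI[of _ "{..<h n A}" for A])
    show "\<Union> (\<U> n) = topspace (Psi \<A>)"
      unfolding \<U>_def topspace_Psi by auto
  qed
  have dense: "Psi \<A> closure_of range Inr = topspace (Psi \<A>)"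
    using assms(1) unfolding almost_disjoint_family_def
    by (intro closure_of_isolated_points_Psi) blast
  have "range Inr \<subseteq> topspace (Psi \<A>)"
    by (simp add: topspace_Psi)
  with cover dense have "\<exists>S. (\<forall>n. S n \<subseteq> range Inr \<and> closedin (Psi \<A>) (S n) \<and>
      subtopology (Psi \<A>) (S n) = discrete_topology (S n)) \<and>
      (\<Union>n. St (S n) (\<U> n)) = topspace (Psi \<A>)"
    by (intro assms(2)[unfolded selectively_a_space_def, rule_format] conjI allI)
  then obtain S where "\<forall>n. S n \<subseteq> range Inr \<and> closedin (Psi \<A>) (S n) \<and>
        subtopology (Psi \<A>) (S n) = discrete_topology (S n)"
      and "(\<Union>n. St (S n) (\<U> n)) = topspace (Psi \<A>)"
    by (elim exE conjE)
  then have S: "\<And>n. S n \<subseteq> range Inr" "\<And>n. closedin (Psi \<A>) (S n)"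
      "(\<Union>n. St (S n) (\<U> n)) = topspace (Psi \<A>)"
    by simp_all
  show ?thesis
  proof (intro exI[of _ "\<lambda>n. Inr -` S n"] conjI allI ballI)
    fix n A
    assume "A \<in> \<A>"
    then show "finite (Inr -` S n \<inter> A)"
      using closedin_Psi_finite_trace S(1,2) by blast
  next
    fix A
    assume "A \<in> \<A>"
    then have "Inl A \<in> (\<Union>n. St (S n) (\<U> n))"
      unfolding S(3) topspace_Psi by blast
    then obtain n U where U: "U \<in> \<U> n" "U \<inter> S n \<noteq> {}" "Inl A \<in> U"
      unfolding St_def by blast
    \<comment> \<open>Only one member of the cover contains the point \<open>A\<close>.\<close>
    from U(1,3) have "U = insert (Inl A) (Inr ` (A - {..<h n A}))"
      unfolding \<U>_def by auto
    with U(2) S(1)[of n] obtain k where "k \<in> A - {..<h n A}" "Inr k \<in> S n"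
      by blast
    then show "\<exists>n. \<exists>k \<in> Inr -` S n \<inter> A. h n A \<le> k"
      by (intro exI[of _ n] bexI[of _ k]) auto
  qed
qed

theorem corollary3p3:
  fixes \<A> :: "nat set set"
  assumes "diamond_omega_omega_less"
    and "almost_disjoint_family \<A>"
    and "selectively_a_space (Psi \<A>)"
  shows "countable (topspace (Psi \<A>))"
proof -
  have "countable \<A>"
  proof (rule ccontr)
    assume "uncountable \<A>"
    then obtain a :: "omega1 \<Rightarrow> nat set" where a: "inj a" "range a \<subseteq> \<A>"
      using uncountable_imp_inj_omega1 by blast
    obtain g :: "omega1 \<Rightarrow> nat \<Rightarrow> nat" where g: "\<And>P :: nat \<Rightarrow> nat set.
        (\<forall>n \<alpha>. finite (P n \<inter> a \<alpha>)) \<Longrightarrow> \<exists>\<alpha>. \<forall>n. \<forall>k \<in> P n \<inter> a \<alpha>. k < g \<alpha> n"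
      using diamond_bounds_traces[OF assms(1), of a] by blast
    obtain P :: "nat \<Rightarrow> nat set" where fin: "\<And>n A. A \<in> \<A> \<Longrightarrow> finite (P n \<inter> A)"
      and esc: "\<And>A. A \<in> \<A> \<Longrightarrow> \<exists>n. \<exists>k \<in> P n \<inter> A. g (inv a A) n \<le> k"
      using selectively_a_Psi_escapes[OF assms(2,3), of "\<lambda>n A. g (inv a A) n"] by blast
    obtain \<alpha> where "\<And>n k. k \<in> P n \<inter> a \<alpha> \<Longrightarrow> k < g \<alpha> n"
      using g[of P] fin a(2) by blast
    moreover obtain n k where "k \<in> P n \<inter> a \<alpha>" "g \<alpha> n \<le> k"
      using esc[OF subsetD[OF a(2) rangeI], of \<alpha>] inv_f_f[OF a(1)] by auto
    ultimately show False
      using not_less by blast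
  qed
  then show ?thesis by (simp add: topspace_Psi)
qed

end
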